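(* Let assumptions (A1)--(A5) listed in the context hold, assume $I_{\mathrm{int}}$ is nonempty, and let $m$ be Lipschitz continuous with Lipschitz constant $L_m$. Then $$E_{\mathrm{vel}}\le|I_{\mathrm{int}}|\,L_m^2\,\operatorname{Var}\left(\frac1\lambda\right)\le\frac{|I_{\mathrm{int}}|\,L_m^2}{\lambda_{\min}^4}\operatorname{Var}(\lambda).$$ Consequently, $$E_{\mathrm{int}}=E_{\mathrm{dem}}+O(\operatorname{Var}(\lambda))$$ as $\operatorname{Var}(\lambda)\to0$, provided the support of $\lambda$ remains in the fixed interval $[\lambda_{\min},\lambda_{\max}]$.
   Context: Let $(\Omega,\mathcal F,\mathbb P)$ be a probability space, $0<\lambda_{\min}<\lambda_{\max}$, and $T>0$. Assumptions: (A1) $\lambda:\Omega\to\mathbb R$ is a random variable with $\lambda_{\min}\le\lambda\le\lambda_{\max}$ almost surely. (A2) The cumulative distribution function $F_\lambda$ of $\lambda$ belongs to $C^1([\lambda_{\min},\lambda_{\max}])$, and $\lambda$ has density $\phi_\lambda$. (A3) $D:[0,T]\times\Omega\to[0,\infty)$ is jointly measurable and $D\in L^2(\Omega\times(0,T))$. (A4) $m(t):=\mathbb E[D(t)]$. (A5) $\lambda$ is independent of the process $D$, i.e. $\sigma(\lambda)$ and $\sigma(D(t):t\in[0,T])$ are independent. Notation: $v(s):=\operatorname{Var}(D(s))$; $$I_{\mathrm{int}}:=\left[\frac1{\lambda_{\min}}-\frac1{\lambda_{\max}},\,T-\frac1{\lambda_{\min}}\right],$$ with length $|I_{\mathrm{int}}|$.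 Here $\mathbb E_\lambda,\operatorname{Var}_\lambda$ denote expectation and variance with respect to the law of $\lambda$, and $$E_{\mathrm{int}}:=\int_{I_{\mathrm{int}}}\operatorname{Var}\left(D\left(t+\frac1\lambda\right)\right)\mathrm dt,\quad E_{\mathrm{dem}}:=\int_{I_{\mathrm{int}}}\mathbb E_\lambda\left[v\left(t+\frac1\lambda\right)\right]\mathrm dt,\quad E_{\mathrm{vel}}:=\int_{I_{\mathrm{int}}}\operatorname{Var}_\lambda\left(m\left(t+\frac1\lambda\right)\right)\mathrm dt.$$ In the asymptotic statement the law of $\lambda$ varies while $\lambda_{\min},\lambda_{\max},T$ and $D$ are fixed. *)

theory Defs
  imports "HOL-Probability.Probability" "HOL-Library.Landau_Symbols"
begin

definition C1_on_interval :: "real \<Rightarrow> real \<Rightarrow> (real \<Rightarrow> real) \<Rightarrow> bool" where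
  "C1_on_interval a b f \<longleftrightarrow>
     (\<exists>f'. continuous_on {a..b} f' \<and>
           (\<forall>x\<in>{a..b}. (f has_real_derivative f' x) (at x within {a..b})))"

text \<open>The process \<open>D\<close> is only constrained for times in \<open>[0,T]\<close>; square integrability refers
  to the product of the probability measure with Lebesgue measure on \<open>(0,T)\<close>.\<close>

definition demand_process :: "'a measure \<Rightarrow> real \<Rightarrow> (real \<Rightarrow> 'a \<Rightarrow> real) \<Rightarrow> bool" where
  "demand_process M T D \<longleftrightarrow>
     (\<forall>t\<in>{0..T}. \<forall>\<omega>\<in>space M. 0 \<le> D t \<omega>) \<and>
     (\<lambda>(t, \<omega>). D t \<omega>) \<in> borel_measurable (restrict_space borel {0..T} \<Otimes>\<^sub>M M) \<and>
     integrable (M \<Otimes>\<^sub>M restrict_space lborel {0<..<T}) (\<lambda>(\<omega>, t). (D t \<omega>)\<^sup>2)"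

definition sigma_rv :: "'a measure \<Rightarrow> ('a \<Rightarrow> real) \<Rightarrow> 'a set set" where
  "sigma_rv M X = sigma_sets (space M) {X -` A \<inter> space M | A. A \<in> sets borel}"

definition sigma_process :: "'a measure \<Rightarrow> real \<Rightarrow> (real \<Rightarrow> 'a \<Rightarrow> real) \<Rightarrow> 'a set set" where
  "sigma_process M T D =
     sigma_sets (space M) {D t -` A \<inter> space M | t A. t \<in> {0..T} \<and> A \<in> sets borel}"

text \<open>The random variables \<open>lam\<close> that satisfy the standing assumptions relative to a fixed
  process \<open>D\<close>. Since \<open>D\<close> and the probability space are parameters, letting \<open>lam\<close> range over
  this set is how the law of \<open>lam\<close> varies while everything else is kept fixed. No law is lost:
  if some \<open>lam\<close> is admissible, then every law on \<open>[lmin,lmax]\<close> satisfying the regularity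
  assumptions is the law of an admissible variable, namely of a function of \<open>lam\<close>.\<close>

definition admissible ::
  "'a measure \<Rightarrow> real \<Rightarrow> real \<Rightarrow> real \<Rightarrow> (real \<Rightarrow> 'a \<Rightarrow> real) \<Rightarrow> ('a \<Rightarrow> real) set" where
  "admissible M lmin lmax T D = {lam.
     lam \<in> borel_measurable M \<and>
     (AE \<omega> in M. lmin \<le> lam \<omega> \<and> lam \<omega> \<le> lmax) \<and>
     C1_on_interval lmin lmax (cdf (distr M borel lam)) \<and>
     (\<exists>\<phi> :: real \<Rightarrow> real. (\<forall>x. 0 \<le> \<phi> x) \<and> distributed M lborel lam (\<lambda>x. ennreal (\<phi> x))) \<and>
     prob_space.indep_set M (sigma_rv M lam) (sigma_process M T D)}"

definition I_int :: "real \<Rightarrow> real \<Rightarrow> real \<Rightarrow> real set" where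
  "I_int lmin lmax T = {1 / lmin - 1 / lmax .. T - 1 / lmin}"

text \<open>For \<open>t\<close> in the interval above and \<open>lam\<close> in \<open>[lmin,lmax]\<close>, the time \<open>t + 1 / lam\<close> lies in
  \<open>[0,T]\<close>. As \<open>lam\<close> lies in \<open>[lmin,lmax]\<close> only almost surely, \<open>D\<close> is extended by zero outside
  \<open>[0,T]\<close>. The extension matters on a null set only, but it makes \<open>D (t + 1 / lam)\<close> measurable,
  without which the Bochner integral would be a default value.\<close>

definition zero_ext :: "real \<Rightarrow> (real \<Rightarrow> 'a \<Rightarrow> real) \<Rightarrow> real \<Rightarrow> 'a \<Rightarrow> real" where
  "zero_ext T D t \<omega> = (if t \<in> {0..T} then D t \<omega> else 0)"

definition mean_D :: "'a measure \<Rightarrow> real \<Rightarrow> (real \<Rightarrow> 'a \<Rightarrow> real) \<Rightarrow> real \<Rightarrow> real" where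
  "mean_D M T D s = prob_space.expectation M (zero_ext T D s)"

definition var_D :: "'a measure \<Rightarrow> real \<Rightarrow> (real \<Rightarrow> 'a \<Rightarrow> real) \<Rightarrow> real \<Rightarrow> real" where
  "var_D M T D s = prob_space.variance M (zero_ext T D s)"

definition E_int ::
  "'a measure \<Rightarrow> real \<Rightarrow> real \<Rightarrow> real \<Rightarrow> (real \<Rightarrow> 'a \<Rightarrow> real) \<Rightarrow> ('a \<Rightarrow> real) \<Rightarrow> real" where
  "E_int M lmin lmax T D lam =
     (LINT t:I_int lmin lmax T|lborel.
        prob_space.variance M (\<lambda>\<omega>. zero_ext T D (t + 1 / lam \<omega>) \<omega>))"

definition E_dem ::
  "'a measure \<Rightarrow> real \<Rightarrow> real \<Rightarrow> real \<Rightarrow> (real \<Rightarrow> 'a \<Rightarrow> real) \<Rightarrow> ('a \<Rightarrow> real) \<Rightarrow> real" where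
  "E_dem M lmin lmax T D lam =
     (LINT t:I_int lmin lmax T|lborel.
        prob_space.expectation (distr M borel lam) (\<lambda>l. var_D M T D (t + 1 / l)))"

definition E_vel ::
  "'a measure \<Rightarrow> real \<Rightarrow> real \<Rightarrow> real \<Rightarrow> (real \<Rightarrow> 'a \<Rightarrow> real) \<Rightarrow> ('a \<Rightarrow> real) \<Rightarrow> real" where
  "E_vel M lmin lmax T D lam =
     (LINT t:I_int lmin lmax T|lborel.
        prob_space.variance (distr M borel lam) (\<lambda>l. mean_D M T D (t + 1 / l)))"

end

theory Submission
  imports Defs
begin

text \<open>Conditioning on \<open>lam\<close>, the law of total variance splits \<open>Var (D (t + 1 / lam))\<close> into
  \<open>E[v (t + 1 / lam)] + Var (m (t + 1 / lam))\<close> for almost every \<open>t\<close>, so that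
  \<open>E_int = E_dem + E_vel\<close>. Because the mean minimises the expected squared distance,
  \<open>Var (f X) \<le> E[(f X - f (E X))\<^sup>2] \<le> C\<^sup>2 Var X\<close> for a \<open>C\<close>-Lipschitz \<open>f\<close>; applied to \<open>m\<close> and to
  \<open>x \<mapsto> 1 / x\<close> this bounds \<open>E_vel\<close> by a constant multiple of \<open>Var lam\<close>.\<close>

section \<open>Translations and reciprocals on the real line\<close>

lemma nn_integral_lborel_shift:
  fixes f :: "real \<Rightarrow> ennreal"
  assumes [measurable]: "f \<in> borel_measurable borel"
  shows "(\<integral>\<^sup>+t. f (t + c) \<partial>lborel) = (\<integral>\<^sup>+t. f t \<partial>lborel)"
  using nn_integral_real_affine[of f 1 c] by (simp add: add.commute)

text \<open>Since |1/x - 1/y| = |x - y| / (x y), the lower bound \<open>a\<^sup>2\<close> of the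
  product gives the constant. Its square becomes the factor \<open>1 / lmin ^ 4\<close> of the
  theorem.\<close>

lemma inverse_lipschitz_on:
  fixes a b :: real
  assumes "0 < a"
  shows "(1 / a\<^sup>2)-lipschitz_on {a..b} (\<lambda>x. 1 / x)"
proof (rule lipschitz_onI)
  fix x y assume xy: "x \<in> {a..b}" "y \<in> {a..b}"
  then have pos: "0 < x" "0 < y" using assms by auto
  have "dist (1 / x) (1 / y) = \<bar>x - y\<bar> / (x * y)"
    using pos by (simp add: dist_real_def field_simps abs_div)
  also have "\<dots> \<le> \<bar>x - y\<bar> / a\<^sup>2"
    using xy assms pos by (intro divide_left_mono) (auto simp: power2_eq_square intro!: mult_mono)
  finally show "dist (1 / x) (1 / y) \<le> 1 / a\<^sup>2 * dist x y"
    by (simp add: dist_real_def)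
qed simp

section \<open>Independence and evaluation at a random time\<close>

context prob_space
begin

text \<open>Under independence the joint law is the product of the marginal laws, so Tonelli
  separates the factors. Values in \<open>ennreal\<close> allow infinite expectations, which leaves
  integrability to be settled later.\<close>

lemma indep_var_nn_expectation_mult:
  fixes Y Z :: "'a \<Rightarrow> real"
  assumes "indep_var borel Y borel Z"
    and [measurable]: "f \<in> borel_measurable borel" "g \<in> borel_measurable borel"
  shows "(\<integral>\<^sup>+\<omega>. f (Y \<omega>) * g (Z \<omega>) \<partial>M) = (\<integral>\<^sup>+\<omega>. f (Y \<omega>) \<partial>M) * (\<integral>\<^sup>+\<omega>. (g (Z \<omega>)::ennreal) \<partial>M)"
proof -
  have [measurable]: "Y \<in> borel_measurable M" "Z \<in> borel_measurable M"
    and eq: "distr M borel Y \<Otimes>\<^sub>M distr M borel Z = distr M (borel \<Otimes>\<^sub>M borel) (\<lambda>\<omega>. (Y \<omega>, Z \<omega>))"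
    using assms(1) unfolding indep_var_distribution_eq by auto
  interpret Z: prob_space "distr M borel Z" by (rule prob_space_distr) simp
  have "(\<integral>\<^sup>+\<omega>. f (Y \<omega>) * g (Z \<omega>) \<partial>M)
      = (\<integral>\<^sup>+p. f (fst p) * g (snd p) \<partial>distr M (borel \<Otimes>\<^sub>M borel) (\<lambda>\<omega>. (Y \<omega>, Z \<omega>)))"
    by (subst nn_integral_distr) simp_all
  also have "\<dots> = (\<integral>\<^sup>+y. \<integral>\<^sup>+z. f y * g z \<partial>distr M borel Z \<partial>distr M borel Y)"
    unfolding eq[symmetric] by (subst Z.nn_integral_fst[symmetric]) simp_all
  also have "\<dots> = (\<integral>\<^sup>+\<omega>. f (Y \<omega>) \<partial>M) * (\<integral>\<^sup>+\<omega>. g (Z \<omega>) \<partial>M)"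
    by (simp add: nn_integral_cmult nn_integral_multc nn_integral_distr)
  finally show ?thesis .
qed

text \<open>Joint measurability of \<open>X\<close> with respect to \<open>M\<close> does not make \<open>X\<close> jointly measurable with
  respect to its own sigma-algebra, so independence cannot be applied for fixed \<open>t\<close>, and the
  identity may indeed fail for individual \<open>t\<close>. Integrating over \<open>t\<close> and substituting
  \<open>s = t + \<tau>\<close> leaves only products of a function of \<open>\<tau>\<close> and \<open>X s\<close> at a fixed time \<open>s\<close>.\<close>

lemma AE_nn_expectation_random_time:
  fixes X :: "real \<Rightarrow> 'a \<Rightarrow> real" and \<tau> :: "'a \<Rightarrow> real" and g :: "real \<Rightarrow> ennreal"
  assumes [measurable]: "\<tau> \<in> borel_measurable M"
      "(\<lambda>(s, \<omega>). X s \<omega>) \<in> borel_measurable (borel \<Otimes>\<^sub>M M)" "g \<in> borel_measurable borel"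
    and indep: "\<And>s. indep_var borel \<tau> borel (X s)"
  shows "AE t in lborel. (\<integral>\<^sup>+\<omega>. g (X (t + \<tau> \<omega>) \<omega>) \<partial>M) = (\<integral>\<^sup>+\<omega>. \<integral>\<^sup>+\<omega>'. g (X (t + \<tau> \<omega>) \<omega>') \<partial>M \<partial>M)"
\<comment> \<open>Two nonnegative measurable functions agree almost everywhere once their integrals
  over every Borel set \<open>A\<close> coincide; sigma-finiteness of \<open>lborel\<close> lets
  this include infinite values.\<close>
proof (rule sigma_finite_measure.density_unique[OF sigma_finite_lborel])
  define H where "H s = (\<integral>\<^sup>+\<omega>. g (X s \<omega>) \<partial>M)" for s
  have [measurable]: "H \<in> borel_measurable borel"
    unfolding H_def by measurable
  interpret lM: pair_sigma_finite lborel M ..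
  \<comment> \<open>The kernel \<open>K\<close> is general because it is instantiated twice: with
    \<open>g (X s \<omega>)\<close> for the left side and with \<open>H s\<close>, constant in
    \<open>\<omega>\<close>, for the right side.\<close>
  have shear: "(\<integral>\<^sup>+t. (\<integral>\<^sup>+\<omega>. K (t + \<tau> \<omega>) \<omega> \<partial>M) * indicator A t \<partial>lborel)
      = (\<integral>\<^sup>+s. \<integral>\<^sup>+\<omega>. indicator A (s - \<tau> \<omega>) * K s \<omega> \<partial>M \<partial>lborel)"
    if [measurable]: "(\<lambda>(s, \<omega>). K s \<omega>) \<in> borel_measurable (borel \<Otimes>\<^sub>M M)" "A \<in> sets borel"
    for K :: "real \<Rightarrow> 'a \<Rightarrow> ennreal" and A
  proof -
    have "(\<integral>\<^sup>+t. (\<integral>\<^sup>+\<omega>. K (t + \<tau> \<omega>) \<omega> \<partial>M) * indicator A t \<partial>lborel)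
        = (\<integral>\<^sup>+t. \<integral>\<^sup>+\<omega>. indicator A t * K (t + \<tau> \<omega>) \<omega> \<partial>M \<partial>lborel)"
      by (subst nn_integral_cmult) (simp_all add: mult.commute)
    \<comment> \<open>Writing \<open>t\<close> as
      \<open>(t + \<tau> \<omega>) - \<tau> \<omega>\<close> exhibits the integrand as a function of
      \<open>t + \<tau> \<omega>\<close>, ready for the shift.\<close>
    also have "\<dots> = (\<integral>\<^sup>+\<omega>. \<integral>\<^sup>+t. indicator A ((t + \<tau> \<omega>) - \<tau> \<omega>) * K (t + \<tau> \<omega>) \<omega> \<partial>lborel \<partial>M)"
      by (subst lM.Fubini') simp_all
    also have "\<dots> = (\<integral>\<^sup>+\<omega>. \<integral>\<^sup>+s. indicator A (s - \<tau> \<omega>) * K s \<omega> \<partial>lborel \<partial>M)"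
      by (intro nn_integral_cong nn_integral_lborel_shift) measurable
    also have "\<dots> = (\<integral>\<^sup>+s. \<integral>\<^sup>+\<omega>. indicator A (s - \<tau> \<omega>) * K s \<omega> \<partial>M \<partial>lborel)"
      by (rule lM.Fubini') measurable
    finally show ?thesis .
  qed
  show "density lborel (\<lambda>t. \<integral>\<^sup>+\<omega>. g (X (t + \<tau> \<omega>) \<omega>) \<partial>M)
      = density lborel (\<lambda>t. \<integral>\<^sup>+\<omega>. \<integral>\<^sup>+\<omega>'. g (X (t + \<tau> \<omega>) \<omega>') \<partial>M \<partial>M)"
  proof (rule measure_eqI)
    fix A assume "A \<in> sets (density lborel (\<lambda>t. \<integral>\<^sup>+\<omega>. g (X (t + \<tau> \<omega>) \<omega>) \<partial>M))"
    then have [measurable]: "A \<in> sets borel" by simp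
    have "(\<integral>\<^sup>+\<omega>. indicator A (s - \<tau> \<omega>) * g (X s \<omega>) \<partial>M) = (\<integral>\<^sup>+\<omega>. indicator A (s - \<tau> \<omega>) * H s \<partial>M)" for s
      using indep_var_nn_expectation_mult[OF indep, of "\<lambda>x. indicator A (s - x)" g s]
      by (simp add: H_def nn_integral_multc)
    then show "emeasure (density lborel (\<lambda>t. \<integral>\<^sup>+\<omega>. g (X (t + \<tau> \<omega>) \<omega>) \<partial>M)) A
        = emeasure (density lborel (\<lambda>t. \<integral>\<^sup>+\<omega>. \<integral>\<^sup>+\<omega>'. g (X (t + \<tau> \<omega>) \<omega>') \<partial>M \<partial>M)) A"
      using shear[of "\<lambda>s \<omega>. g (X s \<omega>)" A] shear[of "\<lambda>s \<omega>. H s" A]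
      by (simp add: emeasure_density H_def[symmetric])
  qed simp
qed measurable

section \<open>Variance estimates and the law of total variance\<close>

lemma variance_le_expectation:
  fixes X :: "'a \<Rightarrow> real"
  assumes "integrable M X" "integrable M (\<lambda>\<omega>. (X \<omega>)\<^sup>2)"
  shows "variance X \<le> expectation (\<lambda>\<omega>. (X \<omega> - c)\<^sup>2)"
proof -
  have "expectation (\<lambda>\<omega>. (X \<omega> - c)\<^sup>2)
      = expectation (\<lambda>\<omega>. (X \<omega>)\<^sup>2) - 2 * c * expectation X + c\<^sup>2"
    using assms by (simp add: power2_diff prob_space mult_ac)
  \<comment> \<open>Bias-variance identity. The inequality is used below with \<open>c\<close> the
    image of the mean under a Lipschitz function, and with \<open>c = 0\<close>.\<close>
  also have "\<dots> = variance X + (expectation X - c)\<^sup>2"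
    using assms prob_space by (simp add: variance_eq power2_eq_square algebra_simps)
  finally show ?thesis by simp
qed

lemma variance_shift:
  fixes X :: "'a \<Rightarrow> real"
  assumes "integrable M X"
  shows "variance (\<lambda>\<omega>. c + X \<omega>) = variance X"
  using assms by (simp add: prob_space)

lemma variance_lipschitz_le:
  fixes X :: "'a \<Rightarrow> real" and f :: "real \<Rightarrow> real"
  assumes lip: "C-lipschitz_on {a..b} f"
    and [measurable]: "X \<in> borel_measurable M" "(\<lambda>\<omega>. f (X \<omega>)) \<in> borel_measurable M"
    and bnd: "AE \<omega> in M. X \<omega> \<in> {a..b}"
  shows "variance (\<lambda>\<omega>. f (X \<omega>)) \<le> C\<^sup>2 * variance X"
proof -
  have int_bounded: "integrable M Y" if [measurable]: "Y \<in> borel_measurable M" and "AE \<omega> in M. norm (Y \<omega>) \<le> B"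
    for Y :: "'a \<Rightarrow> real" and B
    using that(2) by (intro integrable_const_bound) auto
  have X: "integrable M X"
    using bnd by (intro int_bounded[of _ "max \<bar>a\<bar> \<bar>b\<bar>"]) auto
  \<comment> \<open>The Lipschitz bound speaks only of points of \<open>{a..b}\<close>, so the
    centre \<open>expectation X\<close> has to lie there too.\<close>
  have ex: "expectation X \<in> {a..b}"
    using integral_ge_const[OF X, of a] integral_le_const[OF X, of b] bnd by auto
  define c where "c = expectation X"
  have le: "AE \<omega> in M. (f (X \<omega>) - f c)\<^sup>2 \<le> C\<^sup>2 * (X \<omega> - c)\<^sup>2"
    using bnd
  proof eventually_elim
    case (elim \<omega>)
    then have "\<bar>f (X \<omega>) - f c\<bar> \<le> C * \<bar>X \<omega> - c\<bar>"
      using lipschitz_onD[OF lip, of "X \<omega>" c] ex by (simp add: dist_real_def c_def)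
    from power_mono[OF this, of 2] show ?case by (simp add: power_mult_distrib)
  qed
  \<comment> \<open>Continuity on a compact interval bounds \<open>f\<close>, which makes
    \<open>f (X \<omega>)\<close> and its square integrable.\<close>
  have "bounded (f ` {a..b})"
    using lipschitz_on_continuous_on[OF lip]
    by (intro compact_imp_bounded compact_continuous_image) auto
  then obtain B where "\<forall>y\<in>f ` {a..b}. norm y \<le> B"
    unfolding bounded_iff ..
  then have B: "\<bar>f x\<bar> \<le> B" if "x \<in> {a..b}" for x
    using that by simp
  have "AE \<omega> in M. \<bar>f (X \<omega>)\<bar> \<le> B"
    using bnd by eventually_elim (rule B)
  then have fX: "integrable M (\<lambda>\<omega>. f (X \<omega>))"
    by (intro int_bounded[of _ B]) simp_all
  have "AE \<omega> in M. \<bar>f (X \<omega>)\<bar>\<^sup>2 \<le> B\<^sup>2"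
    using bnd by eventually_elim (intro power_mono B abs_ge_zero)
  then have fX2: "integrable M (\<lambda>\<omega>. (f (X \<omega>))\<^sup>2)"
    by (intro int_bounded[of _ "B\<^sup>2"]) simp_all
  have "AE \<omega> in M. \<bar>X \<omega> - c\<bar>\<^sup>2 \<le> (b - a)\<^sup>2"
    using bnd
  proof eventually_elim
    case (elim \<omega>)
    with ex show ?case by (intro power_mono) (auto simp: c_def)
  qed
  then have X2: "integrable M (\<lambda>\<omega>. (X \<omega> - c)\<^sup>2)"
    by (intro int_bounded[of _ "(b - a)\<^sup>2"]) simp_all
  have "variance (\<lambda>\<omega>. f (X \<omega>)) \<le> expectation (\<lambda>\<omega>. (f (X \<omega>) - f c)\<^sup>2)"
    by (rule variance_le_expectation[OF fX fX2])
  also have "\<dots> \<le> expectation (\<lambda>\<omega>. C\<^sup>2 * (X \<omega> - c)\<^sup>2)"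
    using X2 le fX fX2 by (intro integral_mono_AE) (auto simp: power2_diff)
  finally show ?thesis by (simp add: c_def)
qed

text \<open>In the application \<open>Y\<close> is the demand at the random time, while
  \<open>G \<omega> \<omega>'\<close> takes the delay from \<open>\<omega>\<close> and the demand
  from an independent copy \<open>\<omega>'\<close>. By \<open>m1\<close> and \<open>m2\<close> both
  have the same first two moments, so the variance of \<open>Y\<close> can be computed on the
  product space by conditioning on the first coordinate.\<close>

lemma total_variance:
  fixes Y :: "'a \<Rightarrow> real" and G :: "'a \<Rightarrow> 'a \<Rightarrow> real"
  assumes [measurable]: "Y \<in> borel_measurable M" "(\<lambda>(\<omega>, \<omega>'). G \<omega> \<omega>') \<in> borel_measurable (M \<Otimes>\<^sub>M M)"
    and nonneg: "\<And>\<omega>. \<omega> \<in> space M \<Longrightarrow> 0 \<le> Y \<omega>"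
      "\<And>\<omega> \<omega>'. \<omega> \<in> space M \<Longrightarrow> \<omega>' \<in> space M \<Longrightarrow> 0 \<le> G \<omega> \<omega>'"
    and m1: "(\<integral>\<^sup>+\<omega>. ennreal (Y \<omega>) \<partial>M) = (\<integral>\<^sup>+\<omega>. \<integral>\<^sup>+\<omega>'. ennreal (G \<omega> \<omega>') \<partial>M \<partial>M)"
    and m2: "(\<integral>\<^sup>+\<omega>. ennreal ((Y \<omega>)\<^sup>2) \<partial>M) = (\<integral>\<^sup>+\<omega>. \<integral>\<^sup>+\<omega>'. ennreal ((G \<omega> \<omega>')\<^sup>2) \<partial>M \<partial>M)"
    and fin: "integrable M (\<lambda>\<omega>. (Y \<omega>)\<^sup>2)"
  shows "variance Y = expectation (\<lambda>\<omega>. variance (G \<omega>)) + variance (\<lambda>\<omega>. expectation (G \<omega>))"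
proof -
  interpret MM: pair_prob_space M M ..
  let ?P = "M \<Otimes>\<^sub>M M" and ?G = "\<lambda>(\<omega>, \<omega>'). G \<omega> \<omega>'" and ?G2 = "\<lambda>(\<omega>, \<omega>'). (G \<omega> \<omega>')\<^sup>2"
  have n1: "(\<integral>\<^sup>+p. ennreal (?G p) \<partial>?P) = (\<integral>\<^sup>+\<omega>. ennreal (Y \<omega>) \<partial>M)"
    unfolding m1 by (subst nn_integral_fst[symmetric]) simp_all
  have n2: "(\<integral>\<^sup>+p. ennreal (?G2 p) \<partial>?P) = (\<integral>\<^sup>+\<omega>. ennreal ((Y \<omega>)\<^sup>2) \<partial>M)"
    unfolding m2 by (subst nn_integral_fst[symmetric]) simp_all
  have Y: "integrable M Y"
    by (rule square_integrable_imp_integrable) (use fin in auto)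
  have G2: "integrable ?P ?G2"
    using fin n2 by (subst integrable_iff_bounded) (auto simp: case_prod_unfold integrable_iff_bounded)
  have G2': "integrable ?P (\<lambda>p. (?G p)\<^sup>2)"
    using G2 by (simp add: case_prod_unfold)
  have G: "integrable ?P ?G"
    by (rule MM.square_integrable_imp_integrable[OF _ G2']) simp
  have e1: "expectation Y = (\<integral>p. ?G p \<partial>?P)"
    using nonneg n1 by (subst (1 2) integral_eq_nn_integral) (auto simp: space_pair_measure)
  have e2: "expectation (\<lambda>\<omega>. (Y \<omega>)\<^sup>2) = (\<integral>p. ?G2 p \<partial>?P)"
    using n2 by (subst (1 2) integral_eq_nn_integral) auto
  define m where "m \<omega> = expectation (G \<omega>)" for \<omega>
  define q where "q \<omega> = expectation (\<lambda>\<omega>'. (G \<omega> \<omega>')\<^sup>2)" for \<omega>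
  have m: "integrable M m" "expectation m = expectation Y"
    using MM.integrable_fst'[OF G] MM.integral_fst'[OF G] e1 by (simp_all add: m_def[abs_def])
  have q: "integrable M q" "expectation q = expectation (\<lambda>\<omega>. (Y \<omega>)\<^sup>2)"
    using MM.integrable_fst'[OF G2] MM.integral_fst'[OF G2] e2 by (simp_all add: q_def[abs_def])
  have [measurable]: "m \<in> borel_measurable M" using m(1) by auto
  \<comment> \<open>Fubini gives integrability of \<open>G \<omega>\<close> and its square for
    almost every \<open>\<omega>\<close> only, hence the variance formula almost everywhere.\<close>
  have v: "AE \<omega> in M. variance (G \<omega>) = q \<omega> - (m \<omega>)\<^sup>2"
    using MM.AE_integrable_fst'[OF G] MM.AE_integrable_fst'[OF G2]
    by eventually_elim (simp add: variance_eq m_def q_def)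
  \<comment> \<open>A variance is nonnegative, so the squared conditional mean is dominated by the
    integrable \<open>q\<close>. Its expectation is then finite and cancels when the two terms below
    are added.\<close>
  have "AE \<omega> in M. norm ((m \<omega>)\<^sup>2) \<le> norm (q \<omega>)"
    using v
  proof eventually_elim
    case (elim \<omega>)
    with variance_positive[of "G \<omega>"] show ?case by simp
  qed
  then have m2': "integrable M (\<lambda>\<omega>. (m \<omega>)\<^sup>2)"
    by (rule Bochner_Integration.integrable_bound[OF q(1), rotated]) simp
  have "expectation (\<lambda>\<omega>. variance (G \<omega>)) = expectation (\<lambda>\<omega>. q \<omega> - (m \<omega>)\<^sup>2)"
    using v q(1) by (intro integral_cong_AE) auto
  moreover have "variance m = expectation (\<lambda>\<omega>. (m \<omega>)\<^sup>2) - (expectation Y)\<^sup>2"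
    using variance_eq[OF m(1) m2'] m(2) by simp
  ultimately show ?thesis
    using q m2' variance_eq[OF Y fin] by (simp add: m_def[symmetric])
qed

end

section \<open>The extension of the process by zero\<close>

lemma borel_measurable_zero_ext:
  assumes "demand_process M T D"
  shows "(\<lambda>(t, \<omega>). zero_ext T D t \<omega>) \<in> borel_measurable (borel \<Otimes>\<^sub>M M)"
proof -
  let ?R = "restrict_space (borel \<Otimes>\<^sub>M M) ({0..T} \<times> space M)"
  have D: "(\<lambda>(t, \<omega>). D t \<omega>) \<in> borel_measurable (restrict_space borel {0..T} \<Otimes>\<^sub>M M)"
    using assms by (simp add: demand_process_def)
  \<comment> \<open>The identity passes from the restriction of the product to the product with a
    restricted factor; the former is the setting in which a function can be extended by a
    constant.\<close>
  have "(\<lambda>p. (fst p, snd p)) \<in> ?R \<rightarrow>\<^sub>M restrict_space borel {0..T} \<Otimes>\<^sub>M M"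
    by (intro measurable_Pair measurable_restrict_space2 measurable_restrict_space1)
       (auto simp: space_restrict_space space_pair_measure)
  from measurable_compose[OF this D] have "(\<lambda>(t, \<omega>). D t \<omega>) \<in> borel_measurable ?R"
    by (simp add: case_prod_unfold)
  then have "(\<lambda>p. if p \<in> {0..T} \<times> space M then case p of (t, \<omega>) \<Rightarrow> D t \<omega> else 0) \<in> borel_measurable (borel \<Otimes>\<^sub>M M)"
    by (subst (asm) measurable_restrict_space_iff[where c = 0]) auto
  then show ?thesis
    by (rule measurable_cong[THEN iffD1, rotated]) (auto simp: zero_ext_def space_pair_measure split: if_splits)
qed

lemma zero_ext_nonneg:
  assumes "demand_process M T D" "\<omega> \<in> space M"
  shows "0 \<le> zero_ext T D t \<omega>"
  using assms by (auto simp: zero_ext_def demand_process_def)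

lemma integrable_zero_ext_square:
  assumes "prob_space M" "demand_process M T D"
  shows "integrable (M \<Otimes>\<^sub>M lborel) (\<lambda>(\<omega>, t). (zero_ext T D t \<omega>)\<^sup>2)"
proof -
  interpret prob_space M by fact
  let ?R = "restrict_space lborel {0<..<T}"
  interpret R: sigma_finite_measure ?R
    by (rule sigma_finite_measure_restrict_space) (auto intro: sigma_finite_lborel)
  note [measurable] = borel_measurable_zero_ext[OF assms(2)]
  have D: "integrable (M \<Otimes>\<^sub>M ?R) (\<lambda>(\<omega>, t). (D t \<omega>)\<^sup>2)"
    using assms(2) by (simp add: demand_process_def)
  then have [measurable]: "(\<lambda>(\<omega>, t). (D t \<omega>)\<^sup>2) \<in> borel_measurable (M \<Otimes>\<^sub>M ?R)"
    by auto
  have "(\<integral>\<^sup>+t. ennreal ((zero_ext T D t \<omega>)\<^sup>2) \<partial>lborel) = (\<integral>\<^sup>+t. ennreal ((D t \<omega>)\<^sup>2) \<partial>?R)" for \<omega>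
  proof -
    \<comment> \<open>Square integrability is given on the open interval, the extension is nonzero
      on the closed one at most; the endpoints form a null set.\<close>
    have "AE t in lborel. t \<noteq> 0 \<and> t \<noteq> T"
      using AE_lborel_singleton[of 0] AE_lborel_singleton[of T] by eventually_elim simp
    then have "(\<integral>\<^sup>+t. ennreal ((zero_ext T D t \<omega>)\<^sup>2) \<partial>lborel)
        = (\<integral>\<^sup>+t. ennreal ((D t \<omega>)\<^sup>2) * indicator {0<..<T} t \<partial>lborel)"
      by (intro nn_integral_cong_AE, eventually_elim) (auto simp: zero_ext_def indicator_def)
    then show ?thesis
      by (simp add: nn_integral_restrict_space)
  qed
  then have eq: "(\<integral>\<^sup>+\<omega>. \<integral>\<^sup>+t. ennreal ((zero_ext T D t \<omega>)\<^sup>2) \<partial>lborel \<partial>M)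
      = (\<integral>\<^sup>+\<omega>. \<integral>\<^sup>+t. ennreal ((D t \<omega>)\<^sup>2) \<partial>?R \<partial>M)"
    by simp
  have "(\<integral>\<^sup>+p. ennreal (norm (case p of (\<omega>, t) \<Rightarrow> (zero_ext T D t \<omega>)\<^sup>2)) \<partial>(M \<Otimes>\<^sub>M lborel))
      = (\<integral>\<^sup>+\<omega>. \<integral>\<^sup>+t. ennreal ((zero_ext T D t \<omega>)\<^sup>2) \<partial>lborel \<partial>M)"
    by (subst lborel.nn_integral_fst[symmetric]) simp_all
  also have "\<dots> = (\<integral>\<^sup>+p. ennreal (norm (case p of (\<omega>, t) \<Rightarrow> (D t \<omega>)\<^sup>2)) \<partial>(M \<Otimes>\<^sub>M ?R))"
    unfolding eq by (subst R.nn_integral_fst[symmetric]) simp_all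
  also have "\<dots> < \<infinity>"
    using D unfolding integrable_iff_bounded by blast
  finally show ?thesis
    unfolding integrable_iff_bounded by simp
qed

section \<open>Independence of the delay and the splitting of the variance\<close>

lemma admissible_indep_var:
  assumes "prob_space M" "demand_process M T D" "lam \<in> admissible M lmin lmax T D"
  shows "prob_space.indep_var M borel (\<lambda>\<omega>. 1 / lam \<omega>) borel (zero_ext T D s)"
proof -
  interpret prob_space M by fact
  note [measurable] = borel_measurable_zero_ext[OF assms(2)]
  have lam: "lam \<in> borel_measurable M" "indep_set (sigma_rv M lam) (sigma_process M T D)"
    using assms(3) by (auto simp: admissible_def)
  have "zero_ext T D s -` A \<inter> space M \<in> sigma_process M T D" if "A \<in> sets borel" for A
  proof (cases "s \<in> {0..T}")
    case True
    then have "zero_ext T D s -` A \<inter> space M = D s -` A \<inter> space M"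
      by (auto simp: zero_ext_def)
    then show ?thesis
      unfolding sigma_process_def using True that by auto
  next
    case False
    \<comment> \<open>Outside \<open>{0..T}\<close> the extension is constant, so its preimages are
      trivial events, which every sigma-algebra contains.\<close>
    then have "zero_ext T D s -` A \<inter> space M \<in> {{}, space M}"
      by (auto simp: zero_ext_def)
    then show ?thesis
      unfolding sigma_process_def by (auto intro: sigma_sets.Empty sigma_sets_top)
  qed
  then have sub: "sigma_rv M (zero_ext T D s) \<subseteq> sigma_process M T D"
    unfolding sigma_rv_def sigma_process_def by (intro sigma_sets_mono) auto
  have "indep_var borel lam borel (zero_ext T D s)"
    unfolding indep_var_eq
  proof (intro conjI)
    have "indep_set (sigma_rv M lam) (sigma_rv M (zero_ext T D s))"
      using lam(2) sub by (auto simp: indep_sets2_eq)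
    then show "indep_set (sigma_sets (space M) {lam -` A \<inter> space M |A. A \<in> sets borel})
        (sigma_sets (space M) {zero_ext T D s -` A \<inter> space M |A. A \<in> sets borel})"
      by (simp add: sigma_rv_def)
  qed (use lam in measurable)
  then have "indep_var borel ((\<lambda>x. 1 / x) \<circ> lam) borel ((\<lambda>x. x) \<circ> zero_ext T D s)"
    by (rule indep_var_compose) simp_all
  then show ?thesis
    by (simp only: comp_def)
qed

text \<open>The law of total variance, available for almost every \<open>t\<close>, is integrated
  over the interval. The hypothesis \<open>vel\<close> keeps \<open>E_vel\<close> from being a
  default value; the theorem derives it from the Lipschitz bound.\<close>

lemma E_int_eq_E_dem_plus_E_vel:
  assumes "prob_space M" and proc: "demand_process M T D"
    and lam: "lam \<in> admissible M lmin lmax T D"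
    and vel: "set_integrable lborel (I_int lmin lmax T)
      (\<lambda>t. prob_space.variance (distr M borel lam) (\<lambda>l. mean_D M T D (t + 1 / l)))"
  shows "E_int M lmin lmax T D lam = E_dem M lmin lmax T D lam + E_vel M lmin lmax T D lam"
proof -
  interpret prob_space M by fact
  note [measurable] = borel_measurable_zero_ext[OF proc]
  have [measurable]: "lam \<in> borel_measurable M"
    using lam by (simp add: admissible_def)
  interpret lM: pair_sigma_finite lborel M ..
  let ?Z = "zero_ext T D"
  define Y where "Y t \<omega> = ?Z (t + 1 / lam \<omega>) \<omega>" for t \<omega>
  have [measurable]: "(\<lambda>(t, \<omega>). Y t \<omega>) \<in> borel_measurable (borel \<Otimes>\<^sub>M M)"
    unfolding Y_def by measurable
  have [measurable]: "mean_D M T D \<in> borel_measurable borel"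
    unfolding mean_D_def[abs_def] by measurable
  have [measurable]: "var_D M T D \<in> borel_measurable borel"
    unfolding var_D_def[abs_def] by measurable
  \<comment> \<open>For each \<open>\<omega>\<close> the shift by \<open>1 / lam \<omega>\<close>
    preserves the integral over all times, so \<open>Y\<close> inherits square integrability from
    the process.\<close>
  have Y2: "integrable (lborel \<Otimes>\<^sub>M M) (\<lambda>(t, \<omega>). (Y t \<omega>)\<^sup>2)"
  proof -
    have "(\<integral>\<^sup>+p. ennreal ((\<lambda>(t, \<omega>). (Y t \<omega>)\<^sup>2) p) \<partial>(lborel \<Otimes>\<^sub>M M))
        = (\<integral>\<^sup>+\<omega>. \<integral>\<^sup>+t. ennreal ((?Z (t + 1 / lam \<omega>) \<omega>)\<^sup>2) \<partial>lborel \<partial>M)"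
      by (subst lM.nn_integral_snd[symmetric]) (simp_all add: Y_def)
    also have "\<dots> = (\<integral>\<^sup>+\<omega>. \<integral>\<^sup>+t. ennreal ((?Z t \<omega>)\<^sup>2) \<partial>lborel \<partial>M)"
      by (intro nn_integral_cong nn_integral_lborel_shift) measurable
    also have "\<dots> = (\<integral>\<^sup>+p. ennreal ((\<lambda>(\<omega>, t). (?Z t \<omega>)\<^sup>2) p) \<partial>(M \<Otimes>\<^sub>M lborel))"
      by (subst lborel.nn_integral_fst[symmetric]) simp_all
    also have "\<dots> < \<infinity>"
      using integrable_zero_ext_square[OF assms(1,2)] unfolding integrable_iff_bounded
      by (simp add: case_prod_unfold)
    finally show ?thesis
      unfolding integrable_iff_bounded by (simp add: case_prod_unfold)
  qed
  note indep = admissible_indep_var[OF assms(1,2) lam]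
  have fin: "AE t in lborel. integrable M (\<lambda>\<omega>. (Y t \<omega>)\<^sup>2)"
    using lM.AE_integrable_fst'[OF Y2] by simp
  have m1: "AE t in lborel. (\<integral>\<^sup>+\<omega>. ennreal (Y t \<omega>) \<partial>M)
      = (\<integral>\<^sup>+\<omega>. \<integral>\<^sup>+\<omega>'. ennreal (?Z (t + 1 / lam \<omega>) \<omega>') \<partial>M \<partial>M)"
    unfolding Y_def by (rule AE_nn_expectation_random_time[OF _ _ _ indep]) measurable
  have m2: "AE t in lborel. (\<integral>\<^sup>+\<omega>. ennreal ((Y t \<omega>)\<^sup>2) \<partial>M)
      = (\<integral>\<^sup>+\<omega>. \<integral>\<^sup>+\<omega>'. ennreal ((?Z (t + 1 / lam \<omega>) \<omega>')\<^sup>2) \<partial>M \<partial>M)"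
    unfolding Y_def
    by (rule AE_nn_expectation_random_time[OF _ _ _ indep, where g = "\<lambda>x. ennreal (x\<^sup>2)"]) measurable
  have decomp: "AE t in lborel. variance (Y t)
      = (\<integral>l. var_D M T D (t + 1 / l) \<partial>distr M borel lam)
        + prob_space.variance (distr M borel lam) (\<lambda>l. mean_D M T D (t + 1 / l))"
    using fin m1 m2
  proof eventually_elim
    case (elim t)
    have "variance (Y t) = expectation (\<lambda>\<omega>. var_D M T D (t + 1 / lam \<omega>))
        + variance (\<lambda>\<omega>. mean_D M T D (t + 1 / lam \<omega>))"
      unfolding var_D_def mean_D_def
      by (rule total_variance) (use elim zero_ext_nonneg[OF proc] in \<open>simp_all add: Y_def\<close>)
    then show ?case
      by (simp add: integral_distr)
  qed
  \<comment> \<open>The variance is at most the second moment, which is integrable in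
    \<open>t\<close> by Fubini applied to \<open>Y2\<close>.\<close>
  have Yint: "integrable lborel (\<lambda>t. variance (Y t))"
  proof (rule Bochner_Integration.integrable_bound)
    show "integrable lborel (\<lambda>t. expectation (\<lambda>\<omega>. (Y t \<omega>)\<^sup>2))"
      using lM.integrable_fst'[OF Y2] by simp
    show "AE t in lborel. norm (variance (Y t)) \<le> norm (expectation (\<lambda>\<omega>. (Y t \<omega>)\<^sup>2))"
      using fin
    proof eventually_elim
      case (elim t)
      have "integrable M (Y t)"
        by (rule square_integrable_imp_integrable[OF _ elim]) simp
      from variance_le_expectation[OF this elim, of 0] variance_positive[of "Y t"] show ?case
        by simp
    qed
  qed measurable
  let ?I = "I_int lmin lmax T"
  have I [measurable]: "?I \<in> sets borel" by (simp add: I_int_def)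
  have Yset: "set_integrable lborel ?I (\<lambda>t. variance (Y t))"
    using integrable_mult_indicator[OF _ Yint, of ?I] by (simp add: set_integrable_def)
  \<comment> \<open>Solving for the integrand of \<open>E_dem\<close> expresses it through two
    functions whose integrability is already known, so the integral of the difference
    splits.\<close>
  have "E_dem M lmin lmax T D lam = (LINT t:?I|lborel. variance (Y t)
      - prob_space.variance (distr M borel lam) (\<lambda>l. mean_D M T D (t + 1 / l)))"
    unfolding E_dem_def set_lebesgue_integral_def using decomp
    by (intro integral_cong_AE) (auto simp: integral_distr)
  also have "\<dots> = E_int M lmin lmax T D lam - E_vel M lmin lmax T D lam"
    using Yset vel by (simp add: set_integral_diff E_int_def E_vel_def Y_def[abs_def])
  finally show ?thesis by simp
qed

section \<open>The Lipschitz bound and the asymptotics\<close>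

lemma admissible_delay_bounds:
  assumes "prob_space M" "0 < lmin" "lam \<in> admissible M lmin lmax T D" "t \<in> I_int lmin lmax T"
  shows "AE \<omega> in M. t + 1 / lam \<omega> \<in> {0..T}"
proof -
  have "AE \<omega> in M. lmin \<le> lam \<omega> \<and> lam \<omega> \<le> lmax"
    using assms(3) by (simp add: admissible_def)
  then show ?thesis
  proof eventually_elim
    case (elim \<omega>)
    then have "1 / lam \<omega> \<le> 1 / lmin" "1 / lmax \<le> 1 / lam \<omega>" "1 / lmax \<le> 1 / lmin" "0 < 1 / lmax"
      using assms(2) by (auto intro!: divide_left_mono mult_pos_pos)
    \<comment> \<open>The endpoints of \<open>I_int\<close> are chosen for this: adding a delay
      between \<open>1 / lmax\<close> and \<open>1 / lmin\<close> gives a time between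
      \<open>1 / lmin\<close> and \<open>T\<close>, where \<open>mean_D\<close> is
      Lipschitz.\<close>
    then show ?case
      using assms(4) unfolding I_int_def atLeastAtMost_iff by linarith
  qed
qed

theorem lemma4p1:
  fixes M :: "'a measure" and lmin lmax T L :: real and D :: "real \<Rightarrow> 'a \<Rightarrow> real"
  assumes "prob_space M"
    and "0 < lmin" and "lmin < lmax" and "0 < T"
    and "demand_process M T D"
    and "I_int lmin lmax T \<noteq> {}"
    and "L-lipschitz_on {0..T} (mean_D M T D)"
  shows "(\<forall>lam \<in> admissible M lmin lmax T D.
            E_vel M lmin lmax T D lam
              \<le> measure lborel (I_int lmin lmax T) * L\<^sup>2 * prob_space.variance M (\<lambda>\<omega>. 1 / lam \<omega>) \<and>
            measure lborel (I_int lmin lmax T) * L\<^sup>2 * prob_space.variance M (\<lambda>\<omega>. 1 / lam \<omega>)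
              \<le> measure lborel (I_int lmin lmax T) * L\<^sup>2 / lmin ^ 4 * prob_space.variance M lam) \<and>
         (\<lambda>lam. E_int M lmin lmax T D lam - E_dem M lmin lmax T D lam)
           \<in> O[inf (filtercomap (\<lambda>lam. prob_space.variance M lam) (nhds 0))
                   (principal (admissible M lmin lmax T D))](\<lambda>lam. prob_space.variance M lam)"
proof -
  interpret prob_space M by fact
  note [measurable] = borel_measurable_zero_ext[OF assms(5)]
  have mD [measurable]: "mean_D M T D \<in> borel_measurable borel"
    unfolding mean_D_def[abs_def] by measurable
  let ?I = "I_int lmin lmax T"
  let ?V = "\<lambda>lam t. prob_space.variance (distr M borel lam) (\<lambda>l. mean_D M T D (t + 1 / l))"
  have I [measurable]: "?I \<in> sets borel" and Ifin: "emeasure lborel ?I < \<infinity>"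
    by (simp_all add: I_int_def emeasure_lborel_Icc_eq)
  \<comment> \<open>Besides the two claimed inequalities, integrability feeds the splitting of
    \<open>E_int\<close>, and nonnegativity of \<open>E_vel\<close> removes the norm in
    \<open>diff\<close>.\<close>
  have bounds: "set_integrable lborel ?I (?V lam)
      \<and> 0 \<le> E_vel M lmin lmax T D lam
      \<and> E_vel M lmin lmax T D lam \<le> measure lborel ?I * L\<^sup>2 * variance (\<lambda>\<omega>. 1 / lam \<omega>)
      \<and> measure lborel ?I * L\<^sup>2 * variance (\<lambda>\<omega>. 1 / lam \<omega>)
          \<le> measure lborel ?I * L\<^sup>2 / lmin ^ 4 * variance lam"
    if adm: "lam \<in> admissible M lmin lmax T D" for lam
  proof -
    have [measurable]: "lam \<in> borel_measurable M"
      and lam: "AE \<omega> in M. lam \<omega> \<in> {lmin..lmax}"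
      using adm by (simp_all add: admissible_def)
    have "AE \<omega> in M. norm (1 / lam \<omega>) \<le> 1 / lmin"
      using lam by eventually_elim (use assms(2) in \<open>auto intro!: divide_left_mono\<close>)
    then have inv: "integrable M (\<lambda>\<omega>. 1 / lam \<omega>)"
      by (intro integrable_const_bound) auto
    have V: "0 \<le> ?V lam t" "?V lam t \<le> L\<^sup>2 * variance (\<lambda>\<omega>. 1 / lam \<omega>)" if "t \<in> ?I" for t
    proof -
      \<comment> \<open>The Lipschitz function acts on the delayed time
        \<open>t + 1 / lam \<omega>\<close>; the deterministic shift \<open>t\<close> then drops out
        of the variance, making the bound uniform in \<open>t\<close>.\<close>
      have "variance (\<lambda>\<omega>. mean_D M T D (t + 1 / lam \<omega>)) \<le> L\<^sup>2 * variance (\<lambda>\<omega>. t + 1 / lam \<omega>)"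
        by (rule variance_lipschitz_le[OF assms(7)])
           (use admissible_delay_bounds[OF assms(1,2) adm that] in auto)
      then show "?V lam t \<le> L\<^sup>2 * variance (\<lambda>\<omega>. 1 / lam \<omega>)"
        unfolding variance_shift[OF inv] by (simp add: integral_distr)
    qed simp
    have VI: "set_integrable lborel ?I (?V lam)"
      unfolding set_integrable_def
    proof (rule Bochner_Integration.integrable_bound)
      show "integrable lborel (\<lambda>t. indicator ?I t * (L\<^sup>2 * variance (\<lambda>\<omega>. 1 / lam \<omega>)))"
        using Ifin by (intro integrable_mult_left integrable_real_indicator) auto
      show "(\<lambda>t. indicator ?I t *\<^sub>R ?V lam t) \<in> borel_measurable lborel"
        by (simp add: integral_distr)
      show "AE t in lborel. norm (indicator ?I t *\<^sub>R ?V lam t)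
          \<le> norm (indicator ?I t * (L\<^sup>2 * variance (\<lambda>\<omega>. 1 / lam \<omega>)))"
        using V by (intro AE_I2) (auto simp: indicator_def)
    qed
    have "0 \<le> E_vel M lmin lmax T D lam"
      unfolding E_vel_def set_lebesgue_integral_def
      by (intro Bochner_Integration.integral_nonneg) simp
    moreover have "E_vel M lmin lmax T D lam \<le> (LINT t:?I|lborel. L\<^sup>2 * variance (\<lambda>\<omega>. 1 / lam \<omega>))"
      unfolding E_vel_def using Ifin V(2) VI
      by (intro set_integral_mono) (auto simp: set_integrable_def)
    then have "E_vel M lmin lmax T D lam \<le> measure lborel ?I * L\<^sup>2 * variance (\<lambda>\<omega>. 1 / lam \<omega>)"
      using Ifin by (simp add: set_lebesgue_integral_def mult_ac)
    moreover have "variance (\<lambda>\<omega>. 1 / lam \<omega>) \<le> 1 / lmin ^ 4 * variance lam"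
      using variance_lipschitz_le[OF inverse_lipschitz_on[OF assms(2)] _ _ lam]
      by (simp add: power_divide flip: power_mult)
    from mult_left_mono[OF this, of "measure lborel ?I * L\<^sup>2"]
    have "measure lborel ?I * L\<^sup>2 * variance (\<lambda>\<omega>. 1 / lam \<omega>)
          \<le> measure lborel ?I * L\<^sup>2 / lmin ^ 4 * variance lam"
      by simp
    ultimately show ?thesis using VI by blast
  qed
  have diff: "norm (E_int M lmin lmax T D lam - E_dem M lmin lmax T D lam)
      \<le> measure lborel ?I * L\<^sup>2 / lmin ^ 4 * norm (variance lam)"
    if "lam \<in> admissible M lmin lmax T D" for lam
    using E_int_eq_E_dem_plus_E_vel[OF assms(1,5) that] bounds[OF that] variance_positive[of lam]
    by simp
  \<comment> \<open>The constant in \<open>diff\<close> is the same for all admissible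
    \<open>lam\<close>, so the estimate holds on the whole principal part of the filter.\<close>
  have "(\<lambda>lam. E_int M lmin lmax T D lam - E_dem M lmin lmax T D lam)
      \<in> O[inf (filtercomap (\<lambda>lam. variance lam) (nhds 0))
             (principal (admissible M lmin lmax T D))](\<lambda>lam. variance lam)"
    by (rule bigoI[where c = "measure lborel ?I * L\<^sup>2 / lmin ^ 4"], unfold eventually_inf_principal,
        intro always_eventually allI impI diff)
  with bounds show ?thesis by blast
qed

end
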